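(* Let $q>0$, $q\ne1$, let $l,\lambda\in\mathbb{R}$ with $l\neq0$, and let $\hbar,\mathbf m,\omega>0$. Then: 1. For each $n\ge0$ the vector $|n\rangle$ is an eigenvector of the $(q;l,\lambda)$-deformed Hamiltonian $H_{l,\lambda,q}$ with eigenvalue $$E_{l,\lambda,q}(n)=\frac{\hbar\omega}{2}\,l^2q^{\lambda-n-1}\big(q[n]_q+[n+1]_q\big).$$ 2. The mean values of $X_{l,\lambda,q}$ and $P_{l,\lambda,q}$ in the states $|n\rangle$ are zero, and their variances are $$(\Delta X_{l,\lambda,q})_n^2=\frac{\hbar}{2\mathbf m\omega}\,l^2q^{\lambda-n-1}\big(q[n]_q+[n+1]_q\big),\qquad (\Delta P_{l,\lambda,q})_n^2=\frac{\mathbf m\hbar\omega}{2}\,l^2q^{\lambda-n-1}\big(q[n]_q+[n+1]_q\big).$$ 3. The position-momentum uncertainty relation is $$(\Delta X_{l,\lambda,q})_n(\Delta P_{l,\lambda,q})_n=\frac{\hbar}{2}\,l^2q^{\lambda-n-1}\big(q[n]_q+[n+1]_q\big),$$ which for the vacuum state reduces to $(\Delta X_{l,\lambda,q})_0(\Delta P_{l,\lambda,q})_0=\frac{\hbar}{2}\,l^2q^{\lambda-1}$.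
   Context: $\mathcal{F}$ is a Hilbert space with orthonormal basis $\{|n\rangle:n=0,1,2,\dots\}$, $[n]_q=\frac{1-q^n}{1-q}$. On the linear span of the basis vectors, $a|n\rangle=\sqrt{l^2q^{\lambda-n}[n]_q}\,|n-1\rangle$ (with $a|0\rangle=0$) and $a^\dagger|n\rangle=\sqrt{l^2q^{\lambda-n-1}[n+1]_q}\,|n+1\rangle$; these satisfy $aa^\dagger-a^\dagger a=l^2q^{-N+\lambda-1}$ with $N|n\rangle=n|n\rangle$ (the $(q;l,\lambda)$-deformed Heisenberg algebra). The deformed position, momentum and Hamiltonian operators are $$X_{l,\lambda,q}=\left(\tfrac{\hbar}{2\mathbf m\omega}\right)^{1/2}(a+a^\dagger),\qquad P_{l,\lambda,q}=-i\left(\tfrac{\mathbf m\hbar\omega}{2}\right)^{1/2}(a-a^\dagger),$$ $$H_{l,\lambda,q}=\tfrac{1}{2\mathbf m}(P_{l,\lambda,q})^2+\tfrac12\mathbf m\omega^2(X_{l,\lambda,q})^2=\tfrac{\hbar\omega}{2}(a^\dagger a+aa^\dagger).$$ For an operator $A$: $\langle A\rangle_n=\langle n|A|n\rangle$, $(\Delta A)_n^2=\langle A^2\rangle_n-\langle A\rangle_n^2$, and $(\Delta A)_n\ge 0$ is its square root. *)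

theory Defs
  imports "HOL-Analysis.Analysis"
begin

text \<open>
  Complex Hilbert spaces.  Completeness and the norm topology are those of the superclass
  \<^class>\<open>banach\<close>.  The inner product is linear in its second argument, as in
  Dirac notation.
\<close>

class complex_hilbert_space = banach +
  fixes scaleC :: "complex \<Rightarrow> 'a \<Rightarrow> 'a"  (infixr \<open>*\<^sub>C\<close> 75)
    and cinner :: "'a \<Rightarrow> 'a \<Rightarrow> complex"
  assumes scaleC_add_right: "c *\<^sub>C (x + y) = c *\<^sub>C x + c *\<^sub>C y"
    and scaleC_add_left: "(c + d) *\<^sub>C x = c *\<^sub>C x + d *\<^sub>C x"
    and scaleC_scaleC: "c *\<^sub>C d *\<^sub>C x = (c * d) *\<^sub>C x"
    and scaleC_one: "1 *\<^sub>C x = x"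
    and scaleR_scaleC: "r *\<^sub>R x = complex_of_real r *\<^sub>C x"
    and cinner_commute: "cinner x y = cnj (cinner y x)"
    and cinner_add_right: "cinner x (y + z) = cinner x y + cinner x z"
    and cinner_scaleC_right: "cinner x (c *\<^sub>C y) = c * cinner x y"
    and cinner_self: "cinner x x = complex_of_real ((norm x)\<^sup>2)"

global_interpretation cvs: vector_space "scaleC :: complex \<Rightarrow> 'a \<Rightarrow> 'a::complex_hilbert_space"
  by unfold_locales
    (simp_all add: scaleC_add_right scaleC_add_left scaleC_scaleC scaleC_one)

definition orthonormal_basis :: "(nat \<Rightarrow> 'a::complex_hilbert_space) \<Rightarrow> bool" where
  "orthonormal_basis e \<longleftrightarrow>
     (\<forall>m n. cinner (e m) (e n) = (if m = n then 1 else 0)) \<and>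
     closure (cvs.span (range e)) = UNIV"

text \<open>
  The linear operator on the linear span of an orthonormal basis \<open>e\<close> that maps \<open>e n\<close> to \<open>f n\<close>;
  see \<open>linear_ext_basis\<close>, \<open>linear_ext_add\<close> and \<open>linear_ext_scaleC\<close> below.  Its values outside
  the span are irrelevant.
\<close>

definition linear_ext ::
  "(nat \<Rightarrow> 'a::complex_hilbert_space) \<Rightarrow> (nat \<Rightarrow> 'a) \<Rightarrow> 'a \<Rightarrow> 'a" where
  "linear_ext e f \<psi> = (\<Sum>n | cinner (e n) \<psi> \<noteq> 0. cinner (e n) \<psi> *\<^sub>C f n)"

definition q_number :: "real \<Rightarrow> nat \<Rightarrow> real" where
  "q_number q n = (1 - q ^ n) / (1 - q)"

definition annihilation ::
  "(nat \<Rightarrow> 'a::complex_hilbert_space) \<Rightarrow> real \<Rightarrow> real \<Rightarrow> real \<Rightarrow> 'a \<Rightarrow> 'a" where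
  "annihilation e q l lam = linear_ext e (\<lambda>n.
     if n = 0 then 0
     else complex_of_real (sqrt (l\<^sup>2 * q powr (lam - real n) * q_number q n)) *\<^sub>C e (n - 1))"

definition creation ::
  "(nat \<Rightarrow> 'a::complex_hilbert_space) \<Rightarrow> real \<Rightarrow> real \<Rightarrow> real \<Rightarrow> 'a \<Rightarrow> 'a" where
  "creation e q l lam = linear_ext e (\<lambda>n.
     complex_of_real (sqrt (l\<^sup>2 * q powr (lam - real n - 1) * q_number q (n + 1))) *\<^sub>C e (n + 1))"

definition position ::
  "(nat \<Rightarrow> 'a::complex_hilbert_space) \<Rightarrow> real \<Rightarrow> real \<Rightarrow> real \<Rightarrow> real \<Rightarrow> real \<Rightarrow> real \<Rightarrow> 'a \<Rightarrow> 'a" where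
  "position e q l lam hbar m \<omega> \<psi> =
     complex_of_real (sqrt (hbar / (2 * m * \<omega>))) *\<^sub>C
       (annihilation e q l lam \<psi> + creation e q l lam \<psi>)"

definition momentum ::
  "(nat \<Rightarrow> 'a::complex_hilbert_space) \<Rightarrow> real \<Rightarrow> real \<Rightarrow> real \<Rightarrow> real \<Rightarrow> real \<Rightarrow> real \<Rightarrow> 'a \<Rightarrow> 'a" where
  "momentum e q l lam hbar m \<omega> \<psi> =
     (- \<i> * complex_of_real (sqrt (m * hbar * \<omega> / 2))) *\<^sub>C
       (annihilation e q l lam \<psi> - creation e q l lam \<psi>)"

definition hamiltonian ::
  "(nat \<Rightarrow> 'a::complex_hilbert_space) \<Rightarrow> real \<Rightarrow> real \<Rightarrow> real \<Rightarrow> real \<Rightarrow> real \<Rightarrow> real \<Rightarrow> 'a \<Rightarrow> 'a" where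
  "hamiltonian e q l lam hbar m \<omega> \<psi> =
     complex_of_real (1 / (2 * m)) *\<^sub>C
       momentum e q l lam hbar m \<omega> (momentum e q l lam hbar m \<omega> \<psi>) +
     complex_of_real (1 / 2 * m * \<omega>\<^sup>2) *\<^sub>C
       position e q l lam hbar m \<omega> (position e q l lam hbar m \<omega> \<psi>)"

definition eigenvector :: "('a::complex_hilbert_space \<Rightarrow> 'a) \<Rightarrow> 'a \<Rightarrow> complex \<Rightarrow> bool" where
  "eigenvector A v c \<longleftrightarrow> v \<noteq> 0 \<and> A v = c *\<^sub>C v"

definition mean_value ::
  "(nat \<Rightarrow> 'a::complex_hilbert_space) \<Rightarrow> ('a \<Rightarrow> 'a) \<Rightarrow> nat \<Rightarrow> complex" where
  "mean_value e A n = cinner (e n) (A (e n))"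

definition op_variance ::
  "(nat \<Rightarrow> 'a::complex_hilbert_space) \<Rightarrow> ('a \<Rightarrow> 'a) \<Rightarrow> nat \<Rightarrow> complex" where
  "op_variance e A n = mean_value e (A \<circ> A) n - (mean_value e A n)\<^sup>2"

text \<open>
  The square root is meaningful when the variance is a nonnegative real number.
\<close>

definition op_deviation ::
  "(nat \<Rightarrow> 'a::complex_hilbert_space) \<Rightarrow> ('a \<Rightarrow> 'a) \<Rightarrow> nat \<Rightarrow> real" where
  "op_deviation e A n = sqrt (Re (op_variance e A n))"


lemma cinner_zero_right [simp]: "cinner x (0::'a::complex_hilbert_space) = 0"
  using cinner_scaleC_right[of x 0 0] by simp

lemma finite_support_span:
  assumes "orthonormal_basis e" "\<psi> \<in> cvs.span (range e)"
  shows "finite {n. cinner (e n) \<psi> \<noteq> 0}"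
  using assms(2)
proof (induction rule: cvs.span_induct_alt)
  case base
  then show ?case by simp
next
  case (step c x y)
  then obtain k where k: "x = e k" by auto
  have "{n. cinner (e n) (c *\<^sub>C x + y) \<noteq> 0} \<subseteq> insert k {n. cinner (e n) y \<noteq> 0}"
    using assms(1) by (auto simp: orthonormal_basis_def k cinner_add_right cinner_scaleC_right)
  then show ?case using step by (meson finite_insert finite_subset)
qed

lemma linear_ext_superset:
  assumes "finite S" "{n. cinner (e n) \<psi> \<noteq> 0} \<subseteq> S"
  shows "linear_ext e f \<psi> = (\<Sum>n\<in>S. cinner (e n) \<psi> *\<^sub>C f n)"
  unfolding linear_ext_def by (rule sum.mono_neutral_left) (use assms in auto)

lemma linear_ext_basis:
  assumes "orthonormal_basis e"
  shows "linear_ext e f (e n) = f n"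
  using assms linear_ext_superset[of "{n}" e "e n" f]
  by (auto simp: orthonormal_basis_def scaleC_one)

lemma linear_ext_add:
  assumes "orthonormal_basis e" "\<phi> \<in> cvs.span (range e)" "\<psi> \<in> cvs.span (range e)"
  shows "linear_ext e f (\<phi> + \<psi>) = linear_ext e f \<phi> + linear_ext e f \<psi>"
proof -
  define S where "S = {n. cinner (e n) \<phi> \<noteq> 0} \<union> {n. cinner (e n) \<psi> \<noteq> 0}"
  have fin: "finite S" unfolding S_def using assms by (simp add: finite_support_span)
  have "linear_ext e f (\<phi> + \<psi>) = (\<Sum>n\<in>S. cinner (e n) (\<phi> + \<psi>) *\<^sub>C f n)"
    by (rule linear_ext_superset[OF fin]) (auto simp: S_def cinner_add_right)
  moreover have "linear_ext e f \<phi> = (\<Sum>n\<in>S. cinner (e n) \<phi> *\<^sub>C f n)"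
    by (rule linear_ext_superset[OF fin]) (auto simp: S_def)
  moreover have "linear_ext e f \<psi> = (\<Sum>n\<in>S. cinner (e n) \<psi> *\<^sub>C f n)"
    by (rule linear_ext_superset[OF fin]) (auto simp: S_def)
  ultimately show ?thesis
    by (simp add: cinner_add_right scaleC_add_left sum.distrib)
qed

lemma linear_ext_scaleC:
  assumes "orthonormal_basis e" "\<psi> \<in> cvs.span (range e)"
  shows "linear_ext e f (c *\<^sub>C \<psi>) = c *\<^sub>C linear_ext e f \<psi>"
proof -
  have "linear_ext e f (c *\<^sub>C \<psi>) = (\<Sum>n | cinner (e n) \<psi> \<noteq> 0. cinner (e n) (c *\<^sub>C \<psi>) *\<^sub>C f n)"
    by (rule linear_ext_superset) (use assms in \<open>auto simp: cinner_scaleC_right finite_support_span\<close>)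
  then show ?thesis
    by (simp add: linear_ext_def cinner_scaleC_right cvs.scale_sum_right)
qed

lemma linear_ext_in_span:
  assumes "\<And>n. f n \<in> cvs.span (range e)"
  shows "linear_ext e f \<psi> \<in> cvs.span (range e)"
  unfolding linear_ext_def using assms by (intro cvs.span_sum cvs.span_scale)

lemma linear_ext_diff:
  assumes "orthonormal_basis e" "\<phi> \<in> cvs.span (range e)" "\<psi> \<in> cvs.span (range e)"
  shows "linear_ext e f (\<phi> - \<psi>) = linear_ext e f \<phi> - linear_ext e f \<psi>"
  using linear_ext_add[OF assms(1), of "\<phi> - \<psi>" \<psi> f] assms
  by (simp add: cvs.span_diff)

lemma hamiltonian_ladder_form:
  assumes e: "orthonormal_basis e" and \<psi>: "\<psi> \<in> cvs.span (range e)"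
    and pos: "hbar > 0" "m > 0" "\<omega> > 0"
  shows "hamiltonian e q l lam hbar m \<omega> \<psi> =
    complex_of_real (hbar * \<omega> / 2) *\<^sub>C
      (creation e q l lam (annihilation e q l lam \<psi>) +
       annihilation e q l lam (creation e q l lam \<psi>))"
proof -
  let ?S = "cvs.span (range e)"
  define a where "a = annihilation e q l lam"
  define b where "b = creation e q l lam"
  define u where "u = sqrt (hbar / (2 * m * \<omega>))"
  define v where "v = sqrt (m * hbar * \<omega> / 2)"
  have aS: "a x \<in> ?S" for x unfolding a_def annihilation_def
    by (rule linear_ext_in_span) (auto intro: cvs.span_zero cvs.span_scale cvs.span_base)
  have bS: "b x \<in> ?S" for x unfolding b_def creation_def
    by (rule linear_ext_in_span) (auto intro: cvs.span_scale cvs.span_base)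
  have lin: "a (c *\<^sub>C (x + y)) = c *\<^sub>C (a x + a y)" "b (c *\<^sub>C (x + y)) = c *\<^sub>C (b x + b y)"
    "a (c *\<^sub>C (x - y)) = c *\<^sub>C (a x - a y)" "b (c *\<^sub>C (x - y)) = c *\<^sub>C (b x - b y)"
    if "x \<in> ?S" "y \<in> ?S" for c x y
    using that e unfolding a_def b_def annihilation_def creation_def
    by (simp_all add: linear_ext_add linear_ext_diff linear_ext_scaleC cvs.span_add cvs.span_diff)
  have u2: "u * u = hbar / (2 * m * \<omega>)" and v2: "v * v = m * hbar * \<omega> / 2"
    unfolding u_def v_def using pos by simp_all
  define k where "k = complex_of_real (hbar * \<omega> / 4)"
  have "complex_of_real (1 / 2 * m * \<omega>\<^sup>2) * (complex_of_real u * complex_of_real u)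
      = complex_of_real (1 / 2 * m * \<omega>\<^sup>2 * (u * u))" by simp
  also have "\<dots> = k" unfolding u2 k_def of_real_eq_iff using pos
    by (simp add: field_simps power2_eq_square)
  finally have ku: "complex_of_real (1 / 2 * m * \<omega>\<^sup>2) * (complex_of_real u * complex_of_real u) = k" .
  have "complex_of_real (1 / (2 * m)) * ((- \<i> * complex_of_real v) * (- \<i> * complex_of_real v))
      = - complex_of_real (1 / (2 * m) * (v * v))" by (simp add: algebra_simps)
  also have "\<dots> = - k" unfolding v2 k_def using pos by (simp add: field_simps)
  finally have kv: "complex_of_real (1 / (2 * m)) *
      ((- \<i> * complex_of_real v) * (- \<i> * complex_of_real v)) = - k" .
  have "hamiltonian e q l lam hbar m \<omega> \<psi> =
      (complex_of_real (1 / (2 * m)) * ((- \<i> * complex_of_real v) * (- \<i> * complex_of_real v))) *\<^sub>C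
        ((a (a \<psi>) - a (b \<psi>)) - (b (a \<psi>) - b (b \<psi>))) +
      (complex_of_real (1 / 2 * m * \<omega>\<^sup>2) * (complex_of_real u * complex_of_real u)) *\<^sub>C
        ((a (a \<psi>) + a (b \<psi>)) + (b (a \<psi>) + b (b \<psi>)))"
    unfolding hamiltonian_def momentum_def position_def a_def[symmetric] b_def[symmetric]
      u_def[symmetric] v_def[symmetric]
    by (simp only: lin[OF aS bS] cvs.scale_right_diff_distrib[symmetric]
        scaleC_add_right[symmetric] scaleC_scaleC mult.assoc)
  also have "\<dots> = (k + k) *\<^sub>C (b (a \<psi>) + a (b \<psi>))"
    unfolding ku kv
    by (simp only: scaleC_add_left scaleC_add_right cvs.scale_right_diff_distrib cvs.scale_minus_left)
      (simp add: algebra_simps)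
  also have "k + k = complex_of_real (hbar * \<omega> / 2)" unfolding k_def by simp
  finally show ?thesis by (simp add: a_def b_def)
qed

end

theory Submission
  imports Defs
begin

text \<open>Let c_n be \<open>ladder_coeff q l lam n\<close>, and write a for
  \<open>annihilation\<close>, b for \<open>creation\<close>. On the basis a e_n = c_n e_{n-1} and b
  e_n = c_{n+1} e_{n+1}, with c_0 = 0. Hence ba and ab are diagonal with entries c_n^2 and
  c_{n+1}^2, whereas a, b, aa and bb shift the index and have zero diagonal. So the means of X and P
  vanish, and the variances and the energy are each a constant times c_n^2 + c_{n+1}^2, computed in
  \<open>ladder_coeff_sq_sum\<close>; for the energy, \<open>hamiltonian_ladder_form\<close>
  supplies H = (hbar \<omega>/2)(ba + ab). In the product of the deviations m and \<omega>
  cancel.\<close>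

definition ladder_coeff :: "real \<Rightarrow> real \<Rightarrow> real \<Rightarrow> nat \<Rightarrow> real" where
  "ladder_coeff q l lam n = sqrt (l\<^sup>2 * q powr (lam - real n) * q_number q n)"

lemma q_number_0 [simp]: "q_number q 0 = 0"
  by (simp add: q_number_def)

text \<open>1 - q^n and 1 - q never have opposite signs. Needed for the square root in
  \<open>ladder_coeff\<close> to square back to its radicand.\<close>

lemma q_number_nonneg:
  assumes "q > 0"
  shows "q_number q n \<ge> 0"
proof (cases "q < 1")
  case True
  then show ?thesis
    using assms by (simp add: q_number_def power_le_one)
next
  case False
  then show ?thesis
    by (simp add: q_number_def divide_nonpos_nonpos)
qed

lemma ladder_coeff_0 [simp]: "ladder_coeff q l lam 0 = 0"
  by (simp add: ladder_coeff_def)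

lemma ladder_coeff_sq:
  assumes "q > 0"
  shows "(ladder_coeff q l lam n)\<^sup>2 = l\<^sup>2 * q powr (lam - real n) * q_number q n"
  using assms by (simp add: ladder_coeff_def q_number_nonneg)

text \<open>The exponents of q in the two squares differ by one; factoring out the smaller power
  leaves the q in front of [n].\<close>

lemma ladder_coeff_sq_sum:
  assumes "q > 0"
  shows "(ladder_coeff q l lam n)\<^sup>2 + (ladder_coeff q l lam (n + 1))\<^sup>2 =
    l\<^sup>2 * q powr (lam - real n - 1) * (q * q_number q n + q_number q (n + 1))"
proof -
  have "q powr (lam - real n) = q powr (lam - real n - 1) * q"
    using powr_add[of q "lam - real n - 1" 1] assms by simp
  moreover have "lam - real (n + 1) = lam - real n - 1"
    by simp
  ultimately show ?thesis
    unfolding ladder_coeff_sq[OF assms] by (simp add: algebra_simps)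
qed

section \<open>Action of the ladder operators on basis vectors\<close>

lemma linear_ext_0 [simp]: "linear_ext e f 0 = 0"
  by (simp add: linear_ext_def)

lemma annihilation_0 [simp]: "annihilation e q l lam 0 = 0"
  by (simp add: annihilation_def)

lemma creation_0 [simp]: "creation e q l lam 0 = 0"
  by (simp add: creation_def)

text \<open>At \<open>n = 0\<close> the truncated \<open>n - 1\<close> is harmless, because the coefficient vanishes.\<close>
lemma annihilation_basis:
  assumes "orthonormal_basis e"
  shows "annihilation e q l lam (e n) = complex_of_real (ladder_coeff q l lam n) *\<^sub>C e (n - 1)"
  by (simp add: annihilation_def linear_ext_basis[OF assms] ladder_coeff_def)

lemma creation_basis:
  assumes "orthonormal_basis e"
  shows "creation e q l lam (e n) = complex_of_real (ladder_coeff q l lam (n + 1)) *\<^sub>C e (n + 1)"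
  by (simp add: creation_def linear_ext_basis[OF assms] ladder_coeff_def diff_diff_eq add.commute)

lemma annihilation_scaleC_basis:
  assumes "orthonormal_basis e"
  shows "annihilation e q l lam (c *\<^sub>C e n) =
    (c * complex_of_real (ladder_coeff q l lam n)) *\<^sub>C e (n - 1)"
  using annihilation_basis[OF assms] assms
  by (simp add: annihilation_def linear_ext_scaleC cvs.span_base)

lemma creation_scaleC_basis:
  assumes "orthonormal_basis e"
  shows "creation e q l lam (c *\<^sub>C e n) =
    (c * complex_of_real (ladder_coeff q l lam (n + 1))) *\<^sub>C e (n + 1)"
  using creation_basis[OF assms] assms
  by (simp add: creation_def linear_ext_scaleC cvs.span_base)

lemma creation_annihilation_basis:
  assumes "orthonormal_basis e"
  shows "creation e q l lam (annihilation e q l lam (e n)) =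
    complex_of_real ((ladder_coeff q l lam n)\<^sup>2) *\<^sub>C e n"
  \<comment> \<open>(n - 1) + 1 is not n when n = 0, but there both sides vanish since c_0 =
    0.\<close>
  by (cases n)
    (simp_all add: annihilation_basis[OF assms] creation_scaleC_basis[OF assms] power2_eq_square)

lemma annihilation_creation_basis:
  assumes "orthonormal_basis e"
  shows "annihilation e q l lam (creation e q l lam (e n)) =
    complex_of_real ((ladder_coeff q l lam (n + 1))\<^sup>2) *\<^sub>C e n"
  by (simp add: creation_basis[OF assms] annihilation_scaleC_basis[OF assms] power2_eq_square)

section \<open>Diagonal matrix elements\<close>

lemma cinner_basis:
  assumes "orthonormal_basis e"
  shows "cinner (e m) (e n) = (if m = n then 1 else 0)"
  using assms by (simp add: orthonormal_basis_def)

lemma cinner_annihilation_basis: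
  assumes "orthonormal_basis e"
  shows "cinner (e n) (annihilation e q l lam (e n)) = 0"
  \<comment> \<open>For n = 0 the truncated index n - 1 equals n, so c_0 = 0 replaces
    orthogonality.\<close>
  by (cases n) (simp_all add: annihilation_basis[OF assms] cinner_scaleC_right cinner_basis[OF assms])

lemma cinner_creation_basis:
  assumes "orthonormal_basis e"
  shows "cinner (e n) (creation e q l lam (e n)) = 0"
  by (simp add: creation_basis[OF assms] cinner_scaleC_right cinner_basis[OF assms])

lemma cinner_annihilation_twice_basis:
  assumes "orthonormal_basis e"
  shows "cinner (e n) (annihilation e q l lam (annihilation e q l lam (e n))) = 0"
proof (cases n)
  case 0
  then show ?thesis
    by (simp add: annihilation_basis[OF assms] annihilation_scaleC_basis[OF assms])
next
  case (Suc k)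
  then show ?thesis
    by (cases k) (simp_all add: annihilation_basis[OF assms] annihilation_scaleC_basis[OF assms]
        cinner_scaleC_right cinner_basis[OF assms])
qed

lemma cinner_creation_twice_basis:
  assumes "orthonormal_basis e"
  shows "cinner (e n) (creation e q l lam (creation e q l lam (e n))) = 0"
  by (simp add: creation_basis[OF assms] creation_scaleC_basis[OF assms]
      cinner_scaleC_right cinner_basis[OF assms])

section \<open>Linearity on the span\<close>

lemma cinner_diff_right:
  "cinner x (y - z) = cinner x y - cinner (x :: 'a::complex_hilbert_space) z"
  using cinner_add_right[of x "y - z" z] by (simp add: algebra_simps)

text \<open>\<open>linear_ext\<close> is known to be linear on the span; images lie there, so a
  second ladder operator can be distributed over sums of them.\<close>

lemma annihilation_in_span: "annihilation e q l lam \<psi> \<in> cvs.span (range e)"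
  unfolding annihilation_def
  by (rule linear_ext_in_span) (auto intro: cvs.span_zero cvs.span_scale cvs.span_base)

lemma creation_in_span: "creation e q l lam \<psi> \<in> cvs.span (range e)"
  unfolding creation_def
  by (rule linear_ext_in_span) (auto intro: cvs.span_scale cvs.span_base)

text \<open>The order matters: under \<open>OF\<close> the first summand becomes an image of a, the
  second an image of b, as in X and P.\<close>

lemmas ladder_in_span = annihilation_in_span creation_in_span

lemma ladder_scaleC_add:
  assumes "orthonormal_basis e" "\<phi> \<in> cvs.span (range e)" "\<psi> \<in> cvs.span (range e)"
  shows "annihilation e q l lam (c *\<^sub>C (\<phi> + \<psi>)) =
      c *\<^sub>C (annihilation e q l lam \<phi> + annihilation e q l lam \<psi>)"
    and "creation e q l lam (c *\<^sub>C (\<phi> + \<psi>)) =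
      c *\<^sub>C (creation e q l lam \<phi> + creation e q l lam \<psi>)"
  using assms
  by (simp_all add: annihilation_def creation_def linear_ext_add linear_ext_scaleC cvs.span_add)

lemma ladder_scaleC_diff:
  assumes "orthonormal_basis e" "\<phi> \<in> cvs.span (range e)" "\<psi> \<in> cvs.span (range e)"
  shows "annihilation e q l lam (c *\<^sub>C (\<phi> - \<psi>)) =
      c *\<^sub>C (annihilation e q l lam \<phi> - annihilation e q l lam \<psi>)"
    and "creation e q l lam (c *\<^sub>C (\<phi> - \<psi>)) =
      c *\<^sub>C (creation e q l lam \<phi> - creation e q l lam \<psi>)"
  using assms
  by (simp_all add: annihilation_def creation_def linear_ext_diff linear_ext_scaleC cvs.span_diff)

section \<open>Means and variances\<close>

lemma mean_value_position:
  assumes "orthonormal_basis e"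
  shows "mean_value e (position e q l lam hbar m \<omega>) n = 0"
  by (simp add: mean_value_def position_def cinner_scaleC_right cinner_add_right
      cinner_annihilation_basis[OF assms] cinner_creation_basis[OF assms])

lemma mean_value_momentum:
  assumes "orthonormal_basis e"
  shows "mean_value e (momentum e q l lam hbar m \<omega>) n = 0"
  \<comment> \<open>\<open>cvs.scale_minus_left\<close> would pull the sign out of the scalar and
    block \<open>cinner_scaleC_right\<close>.\<close>
  by (simp add: mean_value_def momentum_def cinner_scaleC_right cinner_diff_right
      cinner_annihilation_basis[OF assms] cinner_creation_basis[OF assms]
      del: cvs.scale_minus_left)

lemma op_variance_position:
  assumes e: "orthonormal_basis e" and q: "q > 0" and pos: "hbar > 0" "m > 0" "\<omega> > 0"
  shows "op_variance e (position e q l lam hbar m \<omega>) n =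
    complex_of_real (hbar / (2 * m * \<omega>) * l\<^sup>2 * q powr (lam - real n - 1) *
      (q * q_number q n + q_number q (n + 1)))"
proof -
  define u where "u = sqrt (hbar / (2 * m * \<omega>))"
  have u2: "u * u = hbar / (2 * m * \<omega>)"
    using pos by (simp add: u_def)
  have "op_variance e (position e q l lam hbar m \<omega>) n =
      complex_of_real u * (complex_of_real u *
        complex_of_real ((ladder_coeff q l lam n)\<^sup>2 + (ladder_coeff q l lam (n + 1))\<^sup>2))"
    \<comment> \<open>The mean is set to 0 before \<open>mean_value_def\<close> is unfolded, which
      would hide it; what remains is the mean of XX.\<close>
    unfolding op_variance_def mean_value_position[OF e]
    unfolding mean_value_def comp_def position_def u_def[symmetric]
      ladder_scaleC_add[OF e ladder_in_span]
    by (simp only: cinner_scaleC_right cinner_add_right creation_annihilation_basis[OF e]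
        annihilation_creation_basis[OF e] cinner_annihilation_twice_basis[OF e]
        cinner_creation_twice_basis[OF e] cinner_basis[OF e])
      (simp add: algebra_simps)
  also have "\<dots> = complex_of_real (u * u *
      ((ladder_coeff q l lam n)\<^sup>2 + (ladder_coeff q l lam (n + 1))\<^sup>2))"
    by simp
  finally show ?thesis
    unfolding u2 ladder_coeff_sq_sum[OF q] by (simp only: mult.assoc)
qed

lemma op_variance_momentum:
  assumes e: "orthonormal_basis e" and q: "q > 0" and pos: "hbar > 0" "m > 0" "\<omega> > 0"
  shows "op_variance e (momentum e q l lam hbar m \<omega>) n =
    complex_of_real (m * hbar * \<omega> / 2 * l\<^sup>2 * q powr (lam - real n - 1) *
      (q * q_number q n + q_number q (n + 1)))"
proof -
  define v where "v = sqrt (m * hbar * \<omega> / 2)"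
  have v2: "v * v = m * hbar * \<omega> / 2"
    using pos by (simp add: v_def)
  \<comment> \<open>The mixed terms of (a - b)(a - b) are -(ab + ba); this sign later cancels
    against the square of \<open>- \<i>\<close>.\<close>
  have "op_variance e (momentum e q l lam hbar m \<omega>) n =
      (- \<i> * complex_of_real v) * ((- \<i> * complex_of_real v) *
        (- complex_of_real ((ladder_coeff q l lam n)\<^sup>2 + (ladder_coeff q l lam (n + 1))\<^sup>2)))"
    unfolding op_variance_def mean_value_momentum[OF e]
    unfolding mean_value_def comp_def momentum_def v_def[symmetric]
      ladder_scaleC_diff[OF e ladder_in_span]
    by (simp only: cinner_scaleC_right cinner_diff_right creation_annihilation_basis[OF e]
        annihilation_creation_basis[OF e] cinner_annihilation_twice_basis[OF e]
        cinner_creation_twice_basis[OF e] cinner_basis[OF e])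
      (simp add: algebra_simps)
  also have "\<dots> = complex_of_real (v * v *
      ((ladder_coeff q l lam n)\<^sup>2 + (ladder_coeff q l lam (n + 1))\<^sup>2))"
    by (simp add: algebra_simps)
  finally show ?thesis
    unfolding v2 ladder_coeff_sq_sum[OF q] by (simp only: mult.assoc)
qed

section \<open>Energy levels and the uncertainty product\<close>

lemma eigenvector_hamiltonian:
  assumes e: "orthonormal_basis e" and q: "q > 0" and pos: "hbar > 0" "m > 0" "\<omega> > 0"
  shows "eigenvector (hamiltonian e q l lam hbar m \<omega>) (e n)
    (complex_of_real (hbar * \<omega> / 2 * l\<^sup>2 * q powr (lam - real n - 1) *
      (q * q_number q n + q_number q (n + 1))))"
proof -
  have "hamiltonian e q l lam hbar m \<omega> (e n) =
      complex_of_real (hbar * \<omega> / 2) *\<^sub>C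
        complex_of_real ((ladder_coeff q l lam n)\<^sup>2 + (ladder_coeff q l lam (n + 1))\<^sup>2) *\<^sub>C e n"
    by (simp only: hamiltonian_ladder_form[OF e cvs.span_base[OF rangeI] pos]
        creation_annihilation_basis[OF e] annihilation_creation_basis[OF e]
        scaleC_add_left of_real_add)
  also have "\<dots> = complex_of_real (hbar * \<omega> / 2 *
      (l\<^sup>2 * q powr (lam - real n - 1) * (q * q_number q n + q_number q (n + 1)))) *\<^sub>C e n"
    by (simp only: scaleC_scaleC of_real_mult[symmetric] ladder_coeff_sq_sum[OF q])
  \<comment> \<open>The inner product of \<open>e n\<close> with itself is 1, that with 0 is
    0.\<close>
  moreover have "e n \<noteq> 0"
    using cinner_basis[OF e, of n n] by auto
  ultimately show ?thesis
    by (simp only: eigenvector_def mult.assoc simp_thms)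
qed

lemma op_deviation_product:
  assumes e: "orthonormal_basis e" and q: "q > 0" and pos: "hbar > 0" "m > 0" "\<omega> > 0"
  shows "op_deviation e (position e q l lam hbar m \<omega>) n *
      op_deviation e (momentum e q l lam hbar m \<omega>) n =
    hbar / 2 * l\<^sup>2 * q powr (lam - real n - 1) * (q * q_number q n + q_number q (n + 1))"
proof -
  define w where
    "w = l\<^sup>2 * q powr (lam - real n - 1) * (q * q_number q n + q_number q (n + 1))"
  \<comment> \<open>Ensures that the root of the square below is \<open>hbar / 2 * w\<close> itself,
    not an absolute value.\<close>
  have w: "w \<ge> 0"
    using q by (simp add: w_def q_number_nonneg)
  have "op_deviation e (position e q l lam hbar m \<omega>) n *
      op_deviation e (momentum e q l lam hbar m \<omega>) n =
      sqrt (hbar / (2 * m * \<omega>) * w) * sqrt (m * hbar * \<omega> / 2 * w)"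
    by (simp only: op_deviation_def op_variance_position[OF assms] op_variance_momentum[OF assms]
        Re_complex_of_real w_def mult.assoc)
  also have "\<dots> = sqrt ((hbar / 2 * w)\<^sup>2)"
    using pos by (simp add: real_sqrt_mult[symmetric] field_simps power2_eq_square)
  also have "\<dots> = hbar / 2 * w"
    using w pos by simp
  finally show ?thesis
    by (simp only: w_def mult.assoc)
qed

theorem proposition2p5:
  fixes e :: "nat \<Rightarrow> 'a::complex_hilbert_space"
    and q l lam hbar m \<omega> :: real
  assumes "orthonormal_basis e"
    and "q > 0" and "q \<noteq> 1" and "l \<noteq> 0"
    and "hbar > 0" and "m > 0" and "\<omega> > 0"
  shows
    "let X = position e q l lam hbar m \<omega>;
         P = momentum e q l lam hbar m \<omega>;
         H = hamiltonian e q l lam hbar m \<omega>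
     in
       (\<forall>n. eigenvector H (e n)
          (complex_of_real (hbar * \<omega> / 2 * l\<^sup>2 * q powr (lam - real n - 1) *
             (q * q_number q n + q_number q (n + 1))))) \<and>
       (\<forall>n. mean_value e X n = 0 \<and> mean_value e P n = 0 \<and>
          op_variance e X n =
            complex_of_real (hbar / (2 * m * \<omega>) * l\<^sup>2 * q powr (lam - real n - 1) *
              (q * q_number q n + q_number q (n + 1))) \<and>
          op_variance e P n =
            complex_of_real (m * hbar * \<omega> / 2 * l\<^sup>2 * q powr (lam - real n - 1) *
              (q * q_number q n + q_number q (n + 1)))) \<and>
       (\<forall>n. op_deviation e X n * op_deviation e P n =
          hbar / 2 * l\<^sup>2 * q powr (lam - real n - 1) *
            (q * q_number q n + q_number q (n + 1))) \<and>
       op_deviation e X 0 * op_deviation e P 0 = hbar / 2 * l\<^sup>2 * q powr (lam - 1)"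
proof -
  \<comment> \<open>Here \<open>q \<noteq> 1\<close> enters: the quotient (1 - q) / (1 - q) would
    otherwise be 0 / 0 = 0. With [0] = 0 the bracket is 1 in the vacuum.\<close>
  have "q_number q 1 = 1"
    using assms(3) by (simp add: q_number_def)
  then have "op_deviation e (position e q l lam hbar m \<omega>) 0 *
      op_deviation e (momentum e q l lam hbar m \<omega>) 0 = hbar / 2 * l\<^sup>2 * q powr (lam - 1)"
    using op_deviation_product[OF assms(1,2,5-7), of l lam 0] by simp
  then show ?thesis
    unfolding Let_def
    by (intro conjI allI eigenvector_hamiltonian mean_value_position mean_value_momentum
        op_variance_position op_variance_momentum op_deviation_product assms)
qed

end
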